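(* Let $n>k$ be natural numbers such that $k$ divides $n$. Then every graph $G$ on $n$ vertices satisfies $h_k(G)\geqslant f_0(n,k)$.
   Context: All graphs are finite, undirected, without loops or multiple edges. For a graph $G$ and a natural number $k$, $h_k(G)$ denotes the number of unordered pairs of distinct vertices of $G$ whose degrees differ by less than $k$. For natural numbers $n>k$, $$f_0(n,k):=\left(\left\lceil \tfrac{n}{k} \right\rceil - 2\right)\binom{k}{2} + \binom{k+1}{2} + \binom{n-k \left( \left\lceil\frac{n}{k} \right\rceil - 1 \right)-1}{2},$$ where $\binom{m}{2}=m(m-1)/2$. *)

theory Defs
  imports Complex_Main "Graph_Theory.Digraph"
begin

text \<open>
  Finite simple undirected graphs are instances of the locale \<^locale>\<open>graph\<close>: finite loop-free
  digraphs without parallel arcs whose arc relation is symmetric. Each undirected edge corresponds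
  to two opposite arcs, so the number of arcs leaving a vertex is its degree.
\<close>

abbreviation degree :: "('a, 'b) pre_digraph \<Rightarrow> 'a \<Rightarrow> nat" where
  "degree G v \<equiv> out_degree G v"

text \<open>Unordered pairs are two-element sets; the difference is taken in \<^typ>\<open>int\<close>, where it does
  not truncate.\<close>

definition close_pairs :: "nat \<Rightarrow> ('a, 'b) pre_digraph \<Rightarrow> 'a set set" where
  "close_pairs k G = {{u, v} | u v. u \<in> verts G \<and> v \<in> verts G \<and> u \<noteq> v \<and>
     \<bar>int (degree G u) - int (degree G v)\<bar> < int k}"

definition h :: "nat \<Rightarrow> ('a, 'b) pre_digraph \<Rightarrow> nat" where
  "h k G = card (close_pairs k G)"

text \<open>For \<open>n > k \<ge> 1\<close> we have \<open>\<lceil>n / k\<rceil> \<ge> 2\<close> and \<open>k * (\<lceil>n / k\<rceil> - 1) < n\<close>, so none of the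
  subtractions on \<^typ>\<open>nat\<close> truncates.\<close>

definition f0 :: "nat \<Rightarrow> nat \<Rightarrow> nat" where
  "f0 n k = (let q = nat \<lceil>real n / real k\<rceil> in
     (q - 2) * (k choose 2) + ((k + 1) choose 2) + ((n - k * (q - 1) - 1) choose 2))"

end

theory Submission
  imports Defs "HOL-Library.Disjoint_Sets"
begin

text \<open>
  Write \<open>n = q k\<close>; then \<open>f0 n k = q * (k choose 2) + 1\<close>. Sort the vertices into the \<open>q\<close> blocks
  given by \<open>degree div k\<close>. Two vertices of one block form a close pair, so convexity gives at
  least \<open>q * (k choose 2)\<close> close pairs. If there were no more, every block would have exactly \<open>k\<close>
  vertices and degrees from different blocks would differ by at least \<open>k\<close>, so that degrees in the
  top block \<open>T\<close> would exceed those in the bottom block \<open>B\<close> by at least \<open>n - k\<close>. But counting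
  the edges between \<open>T\<close> and \<open>B\<close> shows that the degree sum of \<open>T\<close> exceeds that of \<open>B\<close> by at most
  \<open>k (n - 1 - k)\<close>.
\<close>

lemma two_times_choose_two: "2 * int (m choose 2) = int m * (int m - 1)"
  by (induction m) (auto simp: numeral_2_eq_2 algebra_simps)

lemma f0_mult:
  assumes "k \<ge> 1" and "q \<ge> 2"
  shows "f0 (q * k) k = q * (k choose 2) + 1"
proof -
  obtain r where r: "q = r + 2"
    using assms(2) by (metis add.commute le_Suc_ex)
  obtain l where l: "k = Suc l"
    using assms(1) by (cases k) auto
  have q: "nat \<lceil>real (q * k) / real k\<rceil> = q"
    using assms(1) by simp
  \<comment> \<open>Divisibility enters here: the last block is full, so the last binomial of
    \<open>f0\<close> is \<open>(k - 1) choose 2\<close>.\<close>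
  have "q * k - k * (q - 1) - 1 = k - 1"
    using r by (simp add: algebra_simps)
  then have "f0 (q * k) k = r * (k choose 2) + ((k + 1) choose 2) + ((k - 1) choose 2)"
    unfolding f0_def q Let_def using r by simp
  \<comment> \<open>The second difference of \<open>m choose 2\<close> is 1; this is the source of
    the extra \<open>+ 1\<close>.\<close>
  moreover have "((k + 1) choose 2) + ((k - 1) choose 2) = 2 * (k choose 2) + 1"
    using two_times_choose_two[of "k + 1"] two_times_choose_two[of "k - 1"]
      two_times_choose_two[of k] l by (simp add: algebra_simps)
  ultimately show ?thesis
    using r by (simp add: algebra_simps)
qed

text \<open>Expand the quadratic \<open>m choose 2\<close> around the average \<open>k\<close>; the
  linear terms cancel in the sum. An exact identity, rather than the convexity inequality, also
  settles the case of equality.\<close>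

lemma sum_choose_two_of_average:
  fixes c :: "'b \<Rightarrow> nat"
  assumes "sum c I = card I * k"
  shows "2 * int (\<Sum>i\<in>I. c i choose 2) =
    2 * int (card I * (k choose 2)) + (\<Sum>i\<in>I. (int (c i) - int k)\<^sup>2)"
proof -
  have "2 * int (c i choose 2) =
      2 * int (k choose 2) + (2 * int k - 1) * (int (c i) - int k) + (int (c i) - int k)\<^sup>2" for i
    using two_times_choose_two[of "c i"] two_times_choose_two[of k]
    by (simp add: algebra_simps power2_eq_square)
  then have "2 * int (\<Sum>i\<in>I. c i choose 2) = (\<Sum>i\<in>I. 2 * int (k choose 2)
      + (2 * int k - 1) * (int (c i) - int k) + (int (c i) - int k)\<^sup>2)"
    by (simp add: sum_distrib_left)
  also have "\<dots> = 2 * int (card I * (k choose 2))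
      + (2 * int k - 1) * (int (sum c I) - int (card I * k)) + (\<Sum>i\<in>I. (int (c i) - int k)\<^sup>2)"
    by (simp add: sum.distrib sum_distrib_left[symmetric] sum_subtractf)
  finally show ?thesis
    using assms by simp
qed

lemma card_two_subsets_UN:
  assumes "finite I" and "\<And>i. i \<in> I \<Longrightarrow> finite (B i)" and "disjoint_family_on B I"
  shows "card (\<Union>i\<in>I. {e. e \<subseteq> B i \<and> card e = 2}) = (\<Sum>i\<in>I. card (B i) choose 2)"
proof -
  have "{e. e \<subseteq> B i \<and> card e = 2} \<inter> {e. e \<subseteq> B j \<and> card e = 2} = {}"
    if "i \<in> I" "j \<in> I" "i \<noteq> j" for i j
  proof -
    have "B i \<inter> B j = {}"
      using assms(3) that by (auto simp: disjoint_family_on_def)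
    then show ?thesis
      by (metis (mono_tags, lifting) Int_emptyI card.empty le_inf_iff mem_Collect_eq
          subset_empty zero_neq_numeral)
  qed
  then have "card (\<Union>i\<in>I. {e. e \<subseteq> B i \<and> card e = 2})
      = (\<Sum>i\<in>I. card {e. e \<subseteq> B i \<and> card e = 2})"
    using assms(1,2) by (intro card_UN_disjoint) auto
  then show ?thesis
    using assms(2) by (simp add: n_subsets)
qed

definition block :: "nat \<Rightarrow> ('a, 'b) pre_digraph \<Rightarrow> nat \<Rightarrow> 'a set" where
  "block k G i = {v \<in> verts G. degree G v div k = i}"

context graph
begin

lemma out_degree_eq_card_neighbours: "out_degree G v = card {w. v \<rightarrow>\<^bsub>G\<^esub> w}"
proof -
  have "bij_betw (head G) (out_arcs G v) {w. v \<rightarrow>\<^bsub>G\<^esub> w}"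
    unfolding bij_betw_def
  proof
    show "inj_on (head G) (out_arcs G v)"
      by (rule inj_onI) (auto intro!: no_multi_arcs simp: arc_to_ends_def)
    show "head G ` out_arcs G v = {w. v \<rightarrow>\<^bsub>G\<^esub> w}"
      by (force simp: arcs_ends_def arc_to_ends_def)
  qed
  then show ?thesis
    unfolding out_degree_def by (rule bij_betw_same_card)
qed

lemma finite_neighbours: "finite {w. v \<rightarrow>\<^bsub>G\<^esub> w}"
  by (rule finite_subset[OF _ finite_verts]) auto

lemma degree_less_card_verts:
  assumes "v \<in> verts G"
  shows "degree G v < card (verts G)"
  unfolding out_degree_eq_card_neighbours
  by (rule psubset_card_mono) (use assms adj_not_same in auto)

text \<open>Split each degree in \<open>T\<close> into neighbours outside and inside
  \<open>B\<close>, then count the latter from the side of \<open>B\<close>, where they are bounded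
  by the degrees.\<close>

lemma sum_degree_le:
  assumes "T \<subseteq> verts G" and "B \<subseteq> verts G" and "T \<inter> B = {}"
  shows "(\<Sum>v\<in>T. degree G v) \<le> card T * (card (verts G) - 1 - card B) + (\<Sum>w\<in>B. degree G w)"
proof -
  have fin: "finite T" "finite B"
    using assms finite_subset finite_verts by blast+
  have "degree G v \<le> card (verts G) - 1 - card B + card {w \<in> B. v \<rightarrow>\<^bsub>G\<^esub> w}" if "v \<in> T" for v
  proof -
    \<comment> \<open>Loop-freeness removes \<open>v\<close> itself, which yields the
      \<open>- 1\<close> that the final contradiction depends on.\<close>
    have "{w. v \<rightarrow>\<^bsub>G\<^esub> w} \<subseteq> (verts G - {v} - B) \<union> {w \<in> B. v \<rightarrow>\<^bsub>G\<^esub> w}"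
      using adj_not_same by auto
    then have "degree G v \<le> card ((verts G - {v} - B) \<union> {w \<in> B. v \<rightarrow>\<^bsub>G\<^esub> w})"
      unfolding out_degree_eq_card_neighbours using fin by (intro card_mono) auto
    also have "\<dots> \<le> card (verts G - {v} - B) + card {w \<in> B. v \<rightarrow>\<^bsub>G\<^esub> w}"
      by (rule card_Un_le)
    also have "card (verts G - {v} - B) = card (verts G) - 1 - card B"
      using that assms fin by (subst card_Diff_subset) auto
    finally show ?thesis .
  qed
  then have "(\<Sum>v\<in>T. degree G v)
      \<le> (\<Sum>v\<in>T. card (verts G) - 1 - card B + card {w \<in> B. v \<rightarrow>\<^bsub>G\<^esub> w})"
    by (rule sum_mono)
  also have "\<dots> = card T * (card (verts G) - 1 - card B) + (\<Sum>v\<in>T. card {w \<in> B. v \<rightarrow>\<^bsub>G\<^esub> w})"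
    by (simp add: sum.distrib)
  also have "(\<Sum>v\<in>T. card {w \<in> B. v \<rightarrow>\<^bsub>G\<^esub> w}) = (\<Sum>w\<in>B. card {v \<in> T. v \<rightarrow>\<^bsub>G\<^esub> w})"
    using sum.swap_restrict[OF fin, of "\<lambda>_ _. 1::nat" "\<lambda>v w. v \<rightarrow>\<^bsub>G\<^esub> w"] by simp
  also have "\<dots> \<le> (\<Sum>w\<in>B. degree G w)"
    unfolding out_degree_eq_card_neighbours
    by (intro sum_mono card_mono finite_neighbours) (auto intro: arcs_ends_symmetric[OF sym_arcs])
  finally show ?thesis
    by simp
qed

lemma finite_close_pairs: "finite (close_pairs k G)"
  by (rule finite_subset[of _ "Pow (verts G)"]) (auto simp: close_pairs_def)

lemma two_subsets_block_close:
  assumes "k \<ge> 1"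
  shows "{e. e \<subseteq> block k G i \<and> card e = 2} \<subseteq> close_pairs k G"
proof
  fix e
  assume "e \<in> {e. e \<subseteq> block k G i \<and> card e = 2}"
  then obtain u v where e: "e = {u, v}" "u \<noteq> v" "u \<in> block k G i" "v \<in> block k G i"
    by (auto simp: card_2_iff)
  have "k * i \<le> degree G w \<and> degree G w < k * i + k" if "w \<in> block k G i" for w
    using that assms dividend_less_times_div[of k "degree G w"]
    by (auto simp: block_def)
  from this[OF e(3)] this[OF e(4)] have "\<bar>int (degree G u) - int (degree G v)\<bar> < int k"
    by linarith
  then show "e \<in> close_pairs k G"
    using e unfolding close_pairs_def block_def by blast
qed

text \<open>The equality case: the bound on \<open>h\<close> forces the sum of squared deviations of
  the block sizes to vanish, and leaves no room for a close pair outside \<open>?P\<close>.\<close>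

lemma h_le_imp_blocks:
  assumes "k \<ge> 1" and "card (verts G) = q * k" and "h k G \<le> q * (k choose 2)"
  shows "\<And>i. i < q \<Longrightarrow> card (block k G i) = k"
    and "close_pairs k G = (\<Union>i<q. {e. e \<subseteq> block k G i \<and> card e = 2})" (is "_ = ?P")
proof -
  have fin: "finite (block k G i)" for i
    unfolding block_def by simp
  have disj: "disjoint_family_on (block k G) {..<q}"
    by (auto simp: disjoint_family_on_def block_def)
  \<comment> \<open>Degrees are below \<open>q * k\<close>, so no index reaches
    \<open>q\<close>.\<close>
  have "verts G = (\<Union>i<q. block k G i)"
    using degree_less_card_verts assms(2) by (auto simp: block_def less_mult_imp_div_less)
  then have total: "(\<Sum>i<q. card (block k G i)) = card {..<q} * k"
    using card_UN_disjoint'[OF disj fin] assms(2) by simp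
  have sub: "?P \<subseteq> close_pairs k G"
    using two_subsets_block_close[OF assms(1)] by blast
  have cardP: "card ?P = (\<Sum>i<q. card (block k G i) choose 2)"
    by (rule card_two_subsets_UN) (use fin disj in auto)
  have le: "card ?P \<le> q * (k choose 2)"
    using card_mono[OF finite_close_pairs sub] assms(3) unfolding h_def by simp
  have squares: "2 * int (card ?P) = 2 * int (q * (k choose 2))
      + (\<Sum>i<q. (int (card (block k G i)) - int k)\<^sup>2)"
    using sum_choose_two_of_average[OF total] cardP by simp
  have nonneg: "(\<Sum>i<q. (int (card (block k G i)) - int k)\<^sup>2) \<ge> 0"
    by (rule sum_nonneg) simp
  have "(\<Sum>i<q. (int (card (block k G i)) - int k)\<^sup>2) = 0"
    using squares le nonneg by linarith
  then show "card (block k G i) = k" if "i < q" for i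
    using that by (simp add: sum_nonneg_eq_0_iff)
  have "h k G \<le> card ?P"
    using squares nonneg assms(3) by linarith
  then show "close_pairs k G = ?P"
    using card_seteq[OF finite_close_pairs sub] unfolding h_def by simp
qed

lemma h_gt_mult_choose_two:
  assumes "k \<ge> 1" and "q \<ge> 2" and "card (verts G) = q * k"
  shows "h k G > q * (k choose 2)"
proof (rule ccontr)
  assume "\<not> ?thesis"
  then have "h k G \<le> q * (k choose 2)"
    by simp
  note blocks = h_le_imp_blocks[OF assms(1,3) this]
  \<comment> \<open>Otherwise \<open>u\<close> and \<open>v\<close> would form a close pair not
    contained in a single block.\<close>
  have step: "degree G u + k \<le> degree G v"
    if "u \<in> block k G i" "v \<in> block k G (Suc i)" for u v i
  proof (rule ccontr)
    have dv: "degree G u div k < degree G v div k"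
      using that by (simp add: block_def)
    then have "degree G u < degree G v"
      using div_le_mono linorder_not_le by blast
    moreover assume "\<not> ?thesis"
    ultimately have "{u, v} \<in> close_pairs k G"
      using that unfolding close_pairs_def block_def by fastforce
    then obtain j where "{u, v} \<subseteq> block k G j"
      unfolding blocks(2) by blast
    then show False
      using dv by (simp add: block_def)
  qed
  have gap: "degree G u + Suc i * k \<le> degree G v"
    if "u \<in> block k G 0" "v \<in> block k G (Suc i)" "Suc i < q" for u v i
    using that(2,3)
  proof (induction i arbitrary: v)
    case 0
    then show ?case
      using step[OF that(1)] by simp
  next
    case (Suc i)
    \<comment> \<open>The chain of gaps needs a vertex in each intermediate block.\<close>
    then have "block k G (Suc i) \<noteq> {}"
      using blocks(1)[of "Suc i"] assms(1) by fastforce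
    then obtain w where "w \<in> block k G (Suc i)"
      by blast
    then show ?case
      using Suc.IH[of w] Suc.prems step[of w "Suc i" v] by simp
  qed
  obtain r where r: "q = Suc (Suc r)"
    using assms(2) by (metis Suc_le_D numeral_2_eq_2 Suc_le_mono)
  define B T where "B = block k G 0" and "T = block k G (Suc r)"
  have card: "card B = k" "card T = k"
    unfolding B_def T_def using blocks(1) r by simp_all
  \<comment> \<open>Pairing \<open>T\<close> with \<open>B\<close> turns the pointwise gap into a
    gap between degree sums.\<close>
  then obtain f where f: "bij_betw f T B"
    using assms(1) by (metis bij_betw_iff_card card.infinite not_one_le_zero)
  have "(\<Sum>w\<in>B. degree G w) + k * (Suc r * k) = (\<Sum>v\<in>T. degree G (f v) + Suc r * k)"
    using sum.reindex_bij_betw[OF f, of "degree G"] card by (simp add: sum.distrib)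
  also have "\<dots> \<le> (\<Sum>v\<in>T. degree G v)"
    using f r by (intro sum_mono gap) (auto simp: B_def T_def dest: bij_betwE)
  also have "\<dots> \<le> k * (card (verts G) - 1 - k) + (\<Sum>w\<in>B. degree G w)"
  proof -
    have "T \<subseteq> verts G" "B \<subseteq> verts G" "T \<inter> B = {}"
      by (auto simp: B_def T_def block_def)
    then show ?thesis
      using sum_degree_le[of T B] card by simp
  qed
  \<comment> \<open>Cancel the degree sum of \<open>B\<close> and the factor \<open>k\<close>; the
    right-hand side is one less than the left.\<close>
  finally have "Suc r * k \<le> card (verts G) - 1 - k"
    using assms(1) by simp
  moreover have "card (verts G) = Suc r * k + k"
    using assms(3) r by simp
  ultimately show False
    using assms(1) by simp
qed

end

theorem theorem4:
  fixes n k :: nat and G :: "('a, 'b) pre_digraph"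
  assumes "n > k" and "k dvd n"
    and "graph G" and "card (verts G) = n"
  shows "h k G \<ge> f0 n k"
proof -
  interpret graph G
    by fact
  obtain q where q: "n = q * k"
    using assms(2) by (metis dvd_def mult.commute)
  have k: "k \<ge> 1"
    using assms(1) q by (cases k) auto
  have q2: "q \<ge> 2"
    using assms(1) q by (metis One_nat_def less_2_cases_iff less_irrefl_nat mult_1 mult_zero_left
        not_less not_less_zero)
  show ?thesis
    using h_gt_mult_choose_two[OF k q2] assms(4) unfolding q f0_mult[OF k q2] by simp
qed

end
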